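(* Let $\mathcal{K}$ be a unital associative algebra over $\mathbb{C}$ (not necessarily commutative), let $M$ be an $n\times n$ Manin matrix over $\mathcal{K}$, and let $\sigma_i$, $i=0,\dots,n$, be the coefficients of its characteristic polynomial: $\det^{col}(t\,1_{n\times n}-M)=\sum_{i=0}^n(-1)^i\sigma_it^{n-i}$. Let $v=(v_1,\dots,v_n)$ be a row vector with entries in $\mathcal{K}$ such that $v_k$ commutes with $\sigma_l$ for all $k,l$. Let $D$ be the $n\times n$ matrix whose rows are, from top to bottom, $v,\ vM,\ vM^2,\ \dots,\ vM^{n-1}$. Then $$D\,M=M_{Frob}\,D,\qquad M_{Frob}=\begin{pmatrix}0&1&0&0&\cdots&0\\0&0&1&0&\cdots&0\\ \cdots&\cdots&\cdots&\cdots&\cdots&\cdots\\0&0&0&\cdots&0&1\\(-1)^{n+1}\sigma_n&(-1)^n\sigma_{n-1}&(-1)^{n-1}\sigma_{n-2}&\cdots&-\sigma_2&\sigma_1\end{pmatrix}.$$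
   Context: A (possibly rectangular) matrix $M=(M_{ij})$ with entries in an associative ring $\mathcal{K}$ is called a Manin matrix if (1) entries lying in the same column commute with each other, and (2) $[M_{ij},M_{kl}]=[M_{kj},M_{il}]$ for all $i,j,k,l$, where $[a,b]=ab-ba$. For any $n\times n$ matrix $X$ over a ring, $\det^{col}(X)=\sum_{\sigma\in S_n}\operatorname{sgn}(\sigma)\,X_{\sigma(1)1}X_{\sigma(2)2}\cdots X_{\sigma(n)n}$. The variable $t$ is a formal variable commuting with $\mathcal{K}$. *)

theory Defs
  imports
    "HOL-Library.Poly_Mapping"
    "HOL-Combinatorics.Permutations"
    "Jordan_Normal_Form.Matrix"
begin

class complex_algebra_1 = ring_1 +
  fixes scaleC :: "complex \<Rightarrow> 'a \<Rightarrow> 'a" (infixr \<open>*\<^sub>C\<close> 75)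
  assumes scaleC_add_right: "c *\<^sub>C (x + y) = c *\<^sub>C x + c *\<^sub>C y"
    and scaleC_add_left: "(c + d) *\<^sub>C x = c *\<^sub>C x + d *\<^sub>C x"
    and scaleC_scaleC: "c *\<^sub>C d *\<^sub>C x = (c * d) *\<^sub>C x"
    and scaleC_one: "1 *\<^sub>C x = x"
    and mult_scaleC_left: "(c *\<^sub>C x) * y = c *\<^sub>C (x * y)"
    and mult_scaleC_right: "x * (c *\<^sub>C y) = c *\<^sub>C (x * y)"

definition commutator :: "'a::ring \<Rightarrow> 'a \<Rightarrow> 'a" where
  "commutator a b = a * b - b * a"

definition manin_matrix :: "'a::ring mat \<Rightarrow> bool" where
  "manin_matrix M \<longleftrightarrow>
     (\<forall>i<dim_row M. \<forall>k<dim_row M. \<forall>j<dim_col M.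
        M $$ (i,j) * M $$ (k,j) = M $$ (k,j) * M $$ (i,j)) \<and>
     (\<forall>i<dim_row M. \<forall>k<dim_row M. \<forall>j<dim_col M. \<forall>l<dim_col M.
        commutator (M $$ (i,j)) (M $$ (k,l)) = commutator (M $$ (k,j)) (M $$ (i,l)))"

text \<open>Meant for square matrices only. The entries need not commute, so each product is a
  \<^const>\<open>prod_list\<close>, taken from the first column to the last.\<close>

definition det_col :: "'a::ring_1 mat \<Rightarrow> 'a" where
  "det_col X = (\<Sum>p | p permutes {0..<dim_col X}.
     of_int (sign p) * prod_list (map (\<lambda>j. X $$ (p j, j)) [0..<dim_col X]))"

text \<open>The type \<open>'a poly\<close> has a multiplication only for commutative coefficients. Therefore
  polynomials in a variable commuting with the coefficients are taken as elements of
  \<^typ>\<open>nat \<Rightarrow>\<^sub>0 'a\<close> with its convolution product, where \<^term>\<open>Poly_Mapping.single k a\<close>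
  is the monomial with coefficient \<open>a\<close> and exponent \<open>k\<close>.\<close>

definition poly_const :: "'a::zero \<Rightarrow> (nat \<Rightarrow>\<^sub>0 'a)" where
  "poly_const a = Poly_Mapping.single 0 a"

definition poly_var :: "nat \<Rightarrow>\<^sub>0 'a::zero_neq_one" where
  "poly_var = Poly_Mapping.single 1 1"

definition char_poly_col :: "'a::ring_1 mat \<Rightarrow> (nat \<Rightarrow>\<^sub>0 'a)" where
  "char_poly_col M = det_col (poly_var \<cdot>\<^sub>m 1\<^sub>m (dim_row M) - map_mat poly_const M)"

definition krylov_mat :: "nat \<Rightarrow> 'a::semiring_1 vec \<Rightarrow> 'a mat \<Rightarrow> 'a mat" where
  "krylov_mat n v M = mat_of_rows n (map (\<lambda>k. row (mat_of_row v * M ^\<^sub>m k) 0) [0..<n])"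

text \<open>Rows and columns are numbered from 0, so that the last row has the entry
  \<open>(-1)\<^sup>n\<^sup>+\<^sup>1\<^sup>-\<^sup>j \<sigma>\<^sub>n\<^sub>-\<^sub>j\<close> in column \<open>j\<close>.\<close>

definition frobenius_mat :: "nat \<Rightarrow> (nat \<Rightarrow> 'a::ring_1) \<Rightarrow> 'a mat" where
  "frobenius_mat n \<sigma> = mat n n (\<lambda>(i,j).
     if i + 1 < n then (if j = i + 1 then 1 else 0)
     else (-1) ^ (n + 1 - j) * \<sigma> (n - j))"

end

theory Submission
  imports Defs
begin

text \<open>A Manin matrix \<open>X\<close> has a column determinant that is alternating in the columns, so that
  Cramer's rule gives \<open>adj(X) X = det(X) 1\<close> with the adjugate on the left. The matrix \<open>X = t - M\<close>
  is again Manin. If \<open>A\<^sub>i\<close> are the coefficients of its adjugate and \<open>c\<^sub>i\<close> those of its determinant,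
  then \<open>c\<^sub>i 1 = A\<^sub>i\<^sub>-\<^sub>1 - A\<^sub>i M\<close>; multiplying by \<open>M\<^sup>i\<close> on the right and summing, everything cancels
  and \<open>\<Sum>c\<^sub>i M\<^sup>i = 0\<close>. Applying \<open>v\<close> from the left, which commutes with the coefficients, expresses
  \<open>v M\<^sup>n\<close> by the rows of the Krylov matrix; this is the last row of the claim.\<close>

section \<open>Column determinants of lists of columns\<close>

text \<open>The columns form a list, repetitions allowed, so that swapping, repeating or moving
  columns becomes an operation on lists while the matrix stays fixed.\<close>

definition det_cols :: "'a::ring_1 mat \<Rightarrow> nat list \<Rightarrow> 'a" where
  "det_cols X cs = (\<Sum>p | p permutes {0..<length cs}.
     of_int (sign p) * prod_list (map (\<lambda>i. X $$ (p i, cs ! i)) [0..<length cs]))"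

lemma det_col_eq_det_cols: "det_col X = det_cols X [0..<dim_col X]"
proof -
  have "map (\<lambda>i. X $$ (p i, [0..<dim_col X] ! i)) [0..<dim_col X]
      = map (\<lambda>j. X $$ (p j, j)) [0..<dim_col X]" for p :: "nat \<Rightarrow> nat"
    by (rule map_cong) auto
  then show ?thesis
    unfolding det_col_def det_cols_def by (simp only: length_upt minus_nat.diff_0)
qed

text \<open>Composition with an adjacent transposition pairs the permutations with
  \<open>p i < p (Suc i)\<close> with the others, and paired summands cancel. Pairing avoids
  halving: in an abelian group \<open>x = - x\<close> need not give \<open>x = 0\<close>.\<close>

lemma sum_permutes_antisymmetric:
  fixes f :: "(nat \<Rightarrow> nat) \<Rightarrow> 'a::ab_group_add"
  assumes i: "Suc i < n"
    and anti: "\<And>p. p permutes {0..<n} \<Longrightarrow> f (p \<circ> transpose i (Suc i)) = - f p"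
  shows "(\<Sum>p | p permutes {0..<n}. f p) = 0"
proof -
  let ?P = "{p. p permutes {0..<n}}" and ?t = "transpose i (Suc i)"
  let ?A = "{p \<in> ?P. p i < p (Suc i)}" and ?B = "{p \<in> ?P. \<not> p i < p (Suc i)}"
  have t: "?t permutes {0..<n}"
    using i by (intro permutes_swap_id) auto
  have fin: "finite ?P"
    by (simp add: finite_permutations)
  have tt: "p \<circ> ?t \<circ> ?t = p" for p :: "nat \<Rightarrow> nat"
    by (simp add: comp_assoc)
  have ne: "p i \<noteq> p (Suc i)" if "p \<in> ?P" for p
    using that by (metis mem_Collect_eq n_not_Suc_n permutes_def)
  have "bij_betw (\<lambda>p. p \<circ> ?t) ?A ?B"
  proof (rule bij_betw_byWitness[where f' = "\<lambda>p. p \<circ> ?t"])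
    show "(\<lambda>p. p \<circ> ?t) ` ?A \<subseteq> ?B"
      using t by (auto intro: permutes_compose)
    show "(\<lambda>p. p \<circ> ?t) ` ?B \<subseteq> ?A"
    proof (rule image_subsetI)
      fix p assume p: "p \<in> ?B"
      then have "p (Suc i) < p i"
        using ne[of p] by simp
      with p t show "p \<circ> ?t \<in> ?A"
        by (auto intro: permutes_compose)
    qed
  qed (use tt in auto)
  then have "sum f ?B = (\<Sum>p\<in>?A. f (p \<circ> ?t))"
    by (rule sum.reindex_bij_betw[symmetric])
  also have "\<dots> = - sum f ?A"
    by (simp add: anti sum_negf)
  finally have B: "sum f ?B = - sum f ?A" .
  have "sum f ?P = sum f ?A + sum f ?B"
    using fin by (subst sum.union_disjoint[symmetric]) (auto intro: sum.cong)
  then show ?thesis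
    using B by simp
qed

text \<open>Isolates two adjacent factors of an ordered product. The transposition of their
  positions exchanges the rows of these two factors and leaves the outer products \<open>L\<close>
  and \<open>R\<close> alone.\<close>

lemma det_cols_term_split:
  fixes X :: "'a::ring_1 mat"
  defines "L \<equiv> \<lambda>xs p. prod_list (map (\<lambda>i. X $$ (p i, xs ! i)) [0..<length xs])"
    and "R \<equiv> \<lambda>xs ys p. prod_list (map (\<lambda>i. X $$ (p (length xs + 2 + i), ys ! i)) [0..<length ys])"
  shows "prod_list (map (\<lambda>i. X $$ (p i, (xs @ a # b # ys) ! i)) [0..<length (xs @ a # b # ys)])
    = L xs p * (X $$ (p (length xs), a) * X $$ (p (Suc (length xs)), b)) * R xs ys p" (is ?thesis1)
    and "L xs (p \<circ> transpose (length xs) (Suc (length xs))) = L xs p"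
    and "R xs ys (p \<circ> transpose (length xs) (Suc (length xs))) = R xs ys p"
proof -
  let ?m = "length xs"
  have "[0..<length (xs @ a # b # ys)] = [0..<?m] @ [?m..<?m + (2 + length ys)]"
    using upt_add_eq_append[of 0 ?m "2 + length ys"] by simp
  also have "[?m..<?m + (2 + length ys)] = ?m # Suc ?m # [?m + 2..<length ys + (?m + 2)]"
    using upt_conv_Cons[of ?m "?m + (2 + length ys)"]
      upt_conv_Cons[of "Suc ?m" "?m + (2 + length ys)"] by (simp add: add.commute)
  also have "[?m + 2..<length ys + (?m + 2)] = map (\<lambda>i. i + (?m + 2)) [0..<length ys]"
    by (rule map_add_upt[symmetric])
  finally have upt: "[0..<length (xs @ a # b # ys)] =
      [0..<?m] @ ?m # Suc ?m # map (\<lambda>i. i + (?m + 2)) [0..<length ys]" .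
  have init: "map (\<lambda>i. X $$ (p i, (xs @ a # b # ys) ! i)) [0..<?m]
      = map (\<lambda>i. X $$ (p i, xs ! i)) [0..<?m]"
    by (rule map_cong) (auto simp: nth_append)
  show ?thesis1
    unfolding upt map_append init
    by (simp add: L_def R_def nth_append o_def mult.assoc add.commute)
  show "L xs (p \<circ> transpose ?m (Suc ?m)) = L xs p"
    unfolding L_def by (intro arg_cong[of _ _ prod_list] map_cong) (auto simp: transpose_def)
  show "R xs ys (p \<circ> transpose ?m (Suc ?m)) = R xs ys p"
    unfolding R_def by (intro arg_cong[of _ _ prod_list] map_cong) (auto simp: transpose_def)
qed

lemma sign_comp_adjacent:
  assumes "p permutes {0..<n}"
  shows "sign (p \<circ> transpose i (Suc i)) = - sign p"
  using assms
  by (subst sign_compose)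
     (auto simp: sign_swap_id permutation_swap_id intro: permutation_permutes[THEN iffD2])

section \<open>Manin matrices: alternation and the left adjugate\<close>

context
  fixes X :: "'a::ring_1 mat" and n :: nat
  assumes X: "X \<in> carrier_mat n n" and manin: "manin_matrix X"
begin

lemma manin_column_commute:
  "i < n \<Longrightarrow> k < n \<Longrightarrow> j < n \<Longrightarrow> X $$ (i,j) * X $$ (k,j) = X $$ (k,j) * X $$ (i,j)"
  using manin X unfolding manin_matrix_def by auto

text \<open>The commutator relation rearranged: the sum over both assignments of the columns is
  symmetric under the exchange of the rows \<open>i\<close> and \<open>k\<close>.\<close>

lemma manin_cross:
  "i < n \<Longrightarrow> k < n \<Longrightarrow> j < n \<Longrightarrow> l < n \<Longrightarrow>
    X $$ (i,j) * X $$ (k,l) + X $$ (i,l) * X $$ (k,j)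
    = X $$ (k,j) * X $$ (i,l) + X $$ (k,l) * X $$ (i,j)"
  using manin X unfolding manin_matrix_def commutator_def by (auto simp: algebra_simps)

text \<open>Entries of one column commute, so exchanging the two rows keeps the product and flips
  the sign. Antisymmetry under column swaps would not suffice over a ring with 2-torsion.\<close>

lemma det_cols_adjacent_equal:
  assumes len: "length xs + 2 + length ys = n" and a: "a < n"
  shows "det_cols X (xs @ a # a # ys) = 0"
  unfolding det_cols_def
proof (rule sum_permutes_antisymmetric[where i = "length xs"], goal_cases)
  case (2 p)
  have p: "p permutes {0..<n}"
    using 2 len by simp
  have r: "p (length xs) < n" "p (Suc (length xs)) < n"
    using permutes_in_image[OF p] len by auto
  show ?case
    unfolding det_cols_term_split sign_comp_adjacent[OF p]
    by (simp add: manin_column_commute[OF r a])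
qed simp

lemma det_cols_adjacent_swap:
  assumes len: "length xs + 2 + length ys = n" and a: "a < n" and b: "b < n"
  shows "det_cols X (xs @ a # b # ys) = - det_cols X (xs @ b # a # ys)"
proof -
  let ?f = "\<lambda>cs p. of_int (sign p) * prod_list (map (\<lambda>i. X $$ (p i, cs ! i)) [0..<n])"
  have n: "length (xs @ a # b # ys) = n" "length (xs @ b # a # ys) = n"
    using len by auto
  have ring: "of_int (- s) * (L * C * R) + of_int (- s) * (L * D * R)
      = - (of_int s * (L * A * R) + of_int s * (L * B * R))"
    if "A + B = C + D" for s and L R A B C D :: 'a
  proof -
    have "of_int (- s) * (L * C * R) + of_int (- s) * (L * D * R) = - (of_int s * (L * (C + D) * R))"
      by (simp add: algebra_simps)
    also have "\<dots> = - (of_int s * (L * (A + B) * R))"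
      by (simp only: that)
    finally show ?thesis
      by (simp add: algebra_simps)
  qed
  \<comment> \<open>\<open>manin_cross\<close> controls only the sum of the products for both column
    orders, so the two determinants are added before the pairing of permutations is applied.\<close>
  have "(\<Sum>p | p permutes {0..<n}. ?f (xs @ a # b # ys) p + ?f (xs @ b # a # ys) p) = 0"
  proof (rule sum_permutes_antisymmetric[where i = "length xs"], goal_cases)
    case (2 p)
    have r: "p (length xs) < n" "p (Suc (length xs)) < n"
      using permutes_in_image[OF 2] len by auto
    note split = det_cols_term_split(1)[of X _ xs a b ys, unfolded n]
      det_cols_term_split(1)[of X _ xs b a ys, unfolded n] det_cols_term_split(2,3)
    show ?case
      unfolding split sign_comp_adjacent[OF 2]
      using ring[OF manin_cross[OF r a b]] by simp
  qed (use len in simp)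
  then show ?thesis
    unfolding det_cols_def n by (simp add: sum.distrib eq_neg_iff_add_eq_0)
qed

text \<open>Column \<open>a\<close> passes the columns of \<open>ys\<close> one at a time, each time
  by an adjacent swap that costs one sign.\<close>

lemma det_cols_move:
  assumes "length xs + length ys + length zs + 1 = n" "a < n" "set ys \<subseteq> {..<n}"
  shows "det_cols X (xs @ ys @ a # zs) = (-1) ^ length ys * det_cols X (xs @ a # ys @ zs)"
  using assms
proof (induction ys arbitrary: zs rule: rev_induct)
  case (snoc b ys)
  have "det_cols X (xs @ (ys @ [b]) @ a # zs) = - det_cols X ((xs @ ys) @ a # b # zs)"
    using det_cols_adjacent_swap[of "xs @ ys" zs b a] snoc.prems by simp
  also have "\<dots> = - ((-1) ^ length ys * det_cols X (xs @ a # ys @ b # zs))"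
    using snoc.IH[of "b # zs"] snoc.prems by simp
  finally show ?case
    by simp
qed simp

text \<open>In the sum over \<open>l\<close> of \<open>cofactor k l * X $$ (l, j)\<close>, column \<open>j\<close> takes the place of
  column \<open>k\<close>. It is put in the last position, where its factors stand on the right; the sign
  accounts for moving it back to position \<open>k\<close>.\<close>

definition cofactor :: "nat \<Rightarrow> nat \<Rightarrow> 'a" where
  "cofactor k l = (-1) ^ (n - 1 - k) *
    (\<Sum>p | p permutes {0..<n} \<and> p (n - 1) = l.
      of_int (sign p) * prod_list (map (\<lambda>i. X $$ (p i, ([0..<k] @ [Suc k..<n]) ! i)) [0..<n-1]))"

text \<open>Cramer's rule with the adjugate on the left: the sum is, up to sign, the determinant
  with column \<open>k\<close> removed and column \<open>j\<close> appended. For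
  \<open>j = k\<close> the column moves back to its place; otherwise it occurs twice.\<close>

lemma cofactor_mult:
  assumes k: "k < n" and j: "j < n"
  shows "(\<Sum>l<n. cofactor k l * X $$ (l, j)) = (if k = j then det_col X else 0)"
proof -
  let ?cs = "[0..<k] @ [Suc k..<n]"
  let ?g = "\<lambda>p. of_int (sign p) * prod_list (map (\<lambda>i. X $$ (p i, ?cs ! i)) [0..<n-1])"
  have fin: "finite {p. p permutes {0..<n}}"
    by (simp add: finite_permutations)
  have len: "length ?cs = n - 1" "length (?cs @ [j]) = n"
    using k by auto
  have "map (\<lambda>i. X $$ (p i, (?cs @ [j]) ! i)) [0..<n]
      = map (\<lambda>i. X $$ (p i, ?cs ! i)) [0..<n-1] @ [X $$ (p (n-1), j)]" for p
  proof -
    have upt: "[0..<n] = [0..<n-1] @ [n-1]"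
      using k by (cases n) auto
    have init: "map (\<lambda>i. X $$ (p i, (?cs @ [j]) ! i)) [0..<n-1]
        = map (\<lambda>i. X $$ (p i, ?cs ! i)) [0..<n-1]"
      by (rule map_cong) (use len in \<open>auto simp: nth_append\<close>)
    have last: "(?cs @ [j]) ! (n - 1) = j"
      by (metis len(1) nth_append_length)
    show ?thesis
      unfolding upt map_append init by (simp only: list.map last)
  qed
  then have "det_cols X (?cs @ [j]) = (\<Sum>p | p permutes {0..<n}. ?g p * X $$ (p (n-1), j))"
    unfolding det_cols_def len by (simp add: mult.assoc)
  \<comment> \<open>Expansion along the last column: permutations are grouped by the row
    \<open>l\<close> that they select there.\<close>
  also have "\<dots> = (\<Sum>l\<in>{..<n}. \<Sum>p | p \<in> {p. p permutes {0..<n}} \<and> p (n-1) = l.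
      ?g p * X $$ (p (n-1), j))"
  proof (rule sum.group[symmetric, OF fin])
    show "(\<lambda>p. p (n-1)) ` {p. p permutes {0..<n}} \<subseteq> {..<n}"
      using k permutes_in_image by fastforce
  qed simp
  also have "\<dots> = (\<Sum>l<n. (\<Sum>p | p permutes {0..<n} \<and> p (n-1) = l. ?g p) * X $$ (l, j))"
    by (auto simp: sum_distrib_right intro!: sum.cong)
  finally have expand: "det_cols X (?cs @ [j]) = \<dots>" .
  have "(\<Sum>l<n. cofactor k l * X $$ (l, j)) = (-1) ^ (n-1-k) * det_cols X (?cs @ [j])"
    unfolding expand cofactor_def sum_distrib_left[of _ _ "{..<n}"] mult.assoc ..
  also have "\<dots> = (if k = j then det_col X else 0)"
  proof (cases "k = j")
    case True
    have "[0..<k] @ k # [Suc k..<n] = [0..<n]"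
      using k upt_add_eq_append[of 0 k "n - k"] upt_conv_Cons[of k n] by simp
    moreover have "set [Suc k..<n] \<subseteq> {..<n}"
      by auto
    ultimately have "det_cols X (?cs @ [j]) = (-1) ^ (n-1-k) * det_col X"
      using det_cols_move[of "[0..<k]" "[Suc k..<n]" "[]" k] k X True
      by (auto simp: det_col_eq_det_cols)
    then show ?thesis
      using True by (simp add: minus_one_power_iff)
  next
    case False
    then have "j \<in> set ?cs"
      using j by auto
    then obtain us vs where uv: "?cs = us @ j # vs"
      by (meson split_list)
    have sub: "set (us @ j # vs) \<subseteq> {..<n}" and l: "length (us @ j # vs) = n - 1"
      using k unfolding uv[symmetric] by auto
    \<comment> \<open>The appended copy of \<open>j\<close> moves left past \<open>vs\<close> until
      it is adjacent to the first copy.\<close>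
    have "det_cols X (us @ j # vs @ [j]) = (-1) ^ length vs * det_cols X (us @ j # j # vs)"
      using det_cols_move[of "us @ [j]" vs "[]" j] sub l k by auto
    also have "\<dots> = 0"
      using det_cols_adjacent_equal[of us vs j] l j k by simp
    finally show ?thesis
      using False uv by simp
  qed
  finally show ?thesis .
qed

end

section \<open>Coefficients of polynomials in a central variable\<close>

lemma lookup_mult_single:
  fixes p :: "nat \<Rightarrow>\<^sub>0 'a::semiring_0"
  shows "Poly_Mapping.lookup (p * Poly_Mapping.single b a) k =
    (if b \<le> k then Poly_Mapping.lookup p (k - b) * a else 0)"
proof -
  have "((a when b = q) when k = l + q) = ((a when k = l + b) when b = q)" for l q :: nat
    by (auto simp: when_def)
  then have "Poly_Mapping.lookup (p * Poly_Mapping.single b a) k =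
      (\<Sum>l. (Poly_Mapping.lookup p l * a when k = l + b))"
    by (simp add: lookup_mult lookup_single mult_when)
  also have "\<dots> = (\<Sum>l. (Poly_Mapping.lookup p l * a when b \<le> k) when l = k - b)"
    by (rule Sum_any.cong) (auto simp: when_def)
  finally show ?thesis
    by (simp add: when_def[of _ "b \<le> k"])
qed

lemma lookup_single_mult:
  fixes p :: "nat \<Rightarrow>\<^sub>0 'a::semiring_0"
  shows "Poly_Mapping.lookup (Poly_Mapping.single b a * p) k =
    (if b \<le> k then a * Poly_Mapping.lookup p (k - b) else 0)"
proof -
  have "Poly_Mapping.lookup (Poly_Mapping.single b a * p) k =
      (\<Sum>l. (a * (\<Sum>q. Poly_Mapping.lookup p q when k = l + q)) when b = l)"
    unfolding lookup_mult by (rule Sum_any.cong) (auto simp: lookup_single when_def)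
  also have "\<dots> = a * (\<Sum>q. Poly_Mapping.lookup p q when k = b + q)"
    by simp
  also have "(\<Sum>q. Poly_Mapping.lookup p q when k = b + q)
      = (\<Sum>q. (Poly_Mapping.lookup p q when b \<le> k) when q = k - b)"
    by (rule Sum_any.cong) (auto simp: when_def)
  finally show ?thesis
    by (simp add: when_def[of _ "b \<le> k"])
qed

lemma lookup_of_int_mult:
  fixes p :: "nat \<Rightarrow>\<^sub>0 'a::ring_1"
  shows "Poly_Mapping.lookup (of_int s * p) k = of_int s * Poly_Mapping.lookup p k"
proof -
  have "of_int s * p = Poly_Mapping.single 0 (of_int s) * p"
    by simp
  then show ?thesis
    by (simp only: lookup_single_mult) simp
qed

lemma poly_var_commute:
  fixes p :: "nat \<Rightarrow>\<^sub>0 'a::semiring_1"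
  shows "poly_var * p = p * poly_var"
  unfolding poly_var_def
  by (rule poly_mapping_eqI) (simp add: lookup_mult_single lookup_single_mult)

lemma lookup_monomial_term:
  fixes a :: "'a::ring_1"
  shows "Poly_Mapping.lookup ((-1) ^ i * poly_const a * poly_var ^ k) m
    = (if m = k then (-1) ^ i * a else 0)"
proof -
  have var: "(poly_var :: nat \<Rightarrow>\<^sub>0 'a) ^ k = Poly_Mapping.single k 1"
    by (induction k) (simp_all add: poly_var_def mult_single)
  have "((-1) ^ i :: nat \<Rightarrow>\<^sub>0 'a) = of_int ((-1) ^ i)"
    by simp
  then show ?thesis
    unfolding var
    by (simp only: mult.assoc lookup_of_int_mult)
       (auto simp: poly_const_def mult_single lookup_single when_def)
qed

section \<open>The matrix t - M and its characteristic polynomial\<close>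

lemma char_matrix_index:
  assumes "M \<in> carrier_mat n n" "i < n" "j < n"
  shows "(poly_var \<cdot>\<^sub>m 1\<^sub>m n - map_mat poly_const M) $$ (i,j)
    = (if i = j then poly_var else 0) - poly_const (M $$ (i,j) :: 'a::ring_1)"
  using assms by auto

lemma commutator_diff_central:
  assumes "\<And>z. x * z = z * x" "\<And>z. y * z = z * y"
  shows "commutator (x - a) (y - b) = commutator a b"
  unfolding commutator_def by (simp add: algebra_simps assms(1)[of y] assms(1)[of b] assms(2)[of a])

text \<open>The variable is central and drops out of commutators, and the two minus signs cancel.
  Hence the commutators of entries are the constants given by those of \<open>M\<close>, and both
  Manin conditions speak of commutators only.\<close>

lemma manin_char_matrix:
  fixes M :: "'a::ring_1 mat"
  assumes M: "M \<in> carrier_mat n n" and manin: "manin_matrix M"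
  shows "manin_matrix (poly_var \<cdot>\<^sub>m 1\<^sub>m n - map_mat poly_const M)" (is "manin_matrix ?X")
proof -
  have comm: "commutator (?X $$ (i,j)) (?X $$ (k,l)) = poly_const (commutator (M $$ (i,j)) (M $$ (k,l)))"
    if "i < n" "j < n" "k < n" "l < n" for i j k l
  proof -
    have "commutator (?X $$ (i,j)) (?X $$ (k,l))
        = commutator (poly_const (M $$ (i,j))) (poly_const (M $$ (k,l)))"
      unfolding char_matrix_index[OF M that(1,2)] char_matrix_index[OF M that(3,4)]
      by (rule commutator_diff_central) (auto simp: poly_var_commute)
    then show ?thesis
      by (simp add: commutator_def poly_const_def mult_single single_diff)
  qed
  have "commutator (M $$ (i,j)) (M $$ (k,j)) = 0" if "i < n" "j < n" "k < n" for i j k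
    using manin M that unfolding manin_matrix_def commutator_def by simp
  then have "commutator (?X $$ (i,j)) (?X $$ (k,j)) = 0" if "i < n" "j < n" "k < n" for i j k
    using comm that by (simp add: poly_const_def)
  then have "?X $$ (i,j) * ?X $$ (k,j) = ?X $$ (k,j) * ?X $$ (i,j)"
    if "i < n" "j < n" "k < n" for i j k
    using that unfolding commutator_def by (metis eq_iff_diff_eq_0)
  moreover have "commutator (?X $$ (i,j)) (?X $$ (k,l)) = commutator (?X $$ (k,j)) (?X $$ (i,l))"
    if "i < n" "j < n" "k < n" "l < n" for i j k l
    using manin M that comm unfolding manin_matrix_def by simp
  moreover have "dim_row ?X = n" "dim_col ?X = n"
    using M by auto
  ultimately show ?thesis
    unfolding manin_matrix_def by (simp del: index_minus_mat)
qed

text \<open>A left factor \<open>b t - a\<close> contributes \<open>b\<close> times the coefficient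
  one degree lower and \<open>- a\<close> times that of the same degree. At the top the latter
  vanishes by the degree bound, so both claims share one induction.\<close>

lemma lookup_prod_list_linear:
  fixes fs :: "(nat \<Rightarrow>\<^sub>0 'a::ring_1) list"
  assumes "\<And>f. f \<in> set fs \<Longrightarrow> \<exists>a b. f = Poly_Mapping.single 1 b - Poly_Mapping.single 0 a"
  shows "length fs < k \<Longrightarrow> Poly_Mapping.lookup (prod_list fs) k = 0"
    and "Poly_Mapping.lookup (prod_list fs) (length fs)
      = prod_list (map (\<lambda>f. Poly_Mapping.lookup f 1) fs)"
proof -
  have "(\<forall>k>length fs. Poly_Mapping.lookup (prod_list fs) k = 0) \<and>
      Poly_Mapping.lookup (prod_list fs) (length fs)
      = prod_list (map (\<lambda>f. Poly_Mapping.lookup f 1) fs)"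
    using assms
  proof (induction fs)
    case (Cons f fs)
    obtain a b where f: "f = Poly_Mapping.single 1 b - Poly_Mapping.single 0 a"
      using Cons.prems[of f] by auto
    have "Poly_Mapping.lookup (f * g) k =
        (if 1 \<le> k then b * Poly_Mapping.lookup g (k - 1) else 0) - a * Poly_Mapping.lookup g k" for g k
      unfolding f left_diff_distrib lookup_minus lookup_single_mult by simp
    moreover have "Poly_Mapping.lookup f 1 = b"
      by (simp add: f lookup_minus lookup_single)
    ultimately show ?case
      using Cons by simp
  qed (simp add: lookup_one when_def)
  then show "length fs < k \<Longrightarrow> Poly_Mapping.lookup (prod_list fs) k = 0"
    and "Poly_Mapping.lookup (prod_list fs) (length fs)
      = prod_list (map (\<lambda>f. Poly_Mapping.lookup f 1) fs)"
    by auto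
qed

lemma prod_list_eq_0_if_mem: "0 \<in> set xs \<Longrightarrow> prod_list xs = (0::'a::semiring_1)"
  by (induction xs) auto

text \<open>Each summand is a signed product of \<open>n\<close> linear factors, and only the
  identity permutation takes all of them from the diagonal. Monicity later allows solving for the
  power \<open>n\<close> of \<open>M\<close>.\<close>

lemma lookup_char_poly_col:
  fixes M :: "'a::ring_1 mat"
  assumes M: "M \<in> carrier_mat n n"
  shows "n < k \<Longrightarrow> Poly_Mapping.lookup (char_poly_col M) k = 0"
    and "Poly_Mapping.lookup (char_poly_col M) n = 1"
proof -
  let ?X = "poly_var \<cdot>\<^sub>m 1\<^sub>m n - map_mat poly_const M"
  let ?fs = "\<lambda>p. map (\<lambda>j. ?X $$ (p j, j)) [0..<n]"
  have X: "char_poly_col M = (\<Sum>p | p permutes {0..<n}. of_int (sign p) * prod_list (?fs p))"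
    using M unfolding char_poly_col_def det_col_def by simp
  \<comment> \<open>Off the diagonal the coefficient of the variable is 0, so all entries share one
    linear form.\<close>
  have entry: "?X $$ (p j, j) =
      Poly_Mapping.single 1 (if p j = j then 1 else 0) - Poly_Mapping.single 0 (M $$ (p j, j))"
    if "p permutes {0..<n}" "j < n" for p j
    using char_matrix_index[OF M, of "p j" j] permutes_in_image[OF that(1), of j] that(2)
    by (auto simp: poly_var_def poly_const_def)
  then have lin: "\<exists>a b. f = Poly_Mapping.single 1 b - Poly_Mapping.single 0 a"
    if p: "p permutes {0..<n}" and f: "f \<in> set (?fs p)" for p f
  proof -
    from f obtain j where j: "j < n" "f = ?X $$ (p j, j)"
      unfolding set_map set_upt by fastforce
    show ?thesis
      unfolding j(2) entry[OF p j(1)] by blast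
  qed
  show "Poly_Mapping.lookup (char_poly_col M) k = 0" if "n < k"
    unfolding X lookup_sum lookup_of_int_mult
  proof (intro sum.neutral ballI)
    fix p assume "p \<in> {p. p permutes {0..<n}}"
    then have "Poly_Mapping.lookup (prod_list (?fs p)) k = 0"
      using that by (intro lookup_prod_list_linear(1) lin) simp_all
    then show "of_int (sign p) * Poly_Mapping.lookup (prod_list (?fs p)) k = 0"
      by simp
  qed
  have top: "Poly_Mapping.lookup (prod_list (?fs p)) n = (if p = id then 1 else 0)"
    if p: "p permutes {0..<n}" for p
  proof -
    have "Poly_Mapping.lookup (prod_list (?fs p)) n
        = prod_list (map (\<lambda>f. Poly_Mapping.lookup f 1) (?fs p))"
      using lookup_prod_list_linear(2)[of "?fs p", OF lin[OF p]]
      unfolding length_map length_upt minus_nat.diff_0 .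
    also have "map (\<lambda>f. Poly_Mapping.lookup f 1) (?fs p) = map (\<lambda>j. if p j = j then 1 else 0) [0..<n]"
      unfolding map_map
      by (intro map_cong refl)
        (simp add: entry[OF p] lookup_minus lookup_single del: index_minus_mat)
    also have "prod_list \<dots> = (if p = id then 1 else (0::'a))"
    proof (cases "p = id")
      case True
      have "prod_list (map (\<lambda>_. 1) xs) = (1::'a)" for xs :: "nat list"
        by (induction xs) auto
      then show ?thesis
        using True by simp
    next
      case False
      \<comment> \<open>An index moved by \<open>p\<close> selects an off-diagonal entry, hence a
        factor 0.\<close>
      then obtain j where "p j \<noteq> j"
        by fastforce
      moreover from this have "j < n"
        using p unfolding permutes_def by (metis atLeastLessThan_iff le0)
      ultimately have "0 \<in> set (map (\<lambda>j. if p j = j then 1 else (0::'a)) [0..<n])"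
        by (auto intro!: image_eqI[of _ _ j])
      then show ?thesis
        using False by (simp add: prod_list_eq_0_if_mem)
    qed
    finally show ?thesis .
  qed
  have "Poly_Mapping.lookup (char_poly_col M) n =
      (\<Sum>p | p permutes {0..<n}. if p = id then of_int (sign p) else 0)"
    unfolding X lookup_sum lookup_of_int_mult by (rule sum.cong) (auto simp: top)
  also have "\<dots> = 1"
    by (simp add: finite_permutations permutes_id sum.delta')
  finally show "Poly_Mapping.lookup (char_poly_col M) n = 1" .
qed

section \<open>The Cayley-Hamilton theorem for Manin matrices\<close>

lemma index_mult_mat_sum:
  assumes "A \<in> carrier_mat r n" "B \<in> carrier_mat n c" "i < r" "j < c"
  shows "(A * B) $$ (i,j) = (\<Sum>m<n. A $$ (i,m) * B $$ (m,j))"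
  using assms by (simp add: scalar_prod_def atLeast0LessThan)

text \<open>Powers are defined by a factor on the right; the telescoping sum produces one on the
  left.\<close>

lemma pow_mat_Suc_left:
  assumes "M \<in> carrier_mat n n"
  shows "M ^\<^sub>m Suc k = M * M ^\<^sub>m k"
proof (induction k)
  case (Suc k)
  have "M ^\<^sub>m Suc (Suc k) = M * M ^\<^sub>m k * M"
    using Suc by simp
  also have "\<dots> = M * (M ^\<^sub>m k * M)"
    using assms by (intro assoc_mult_mat) auto
  finally show ?case
    by simp
qed (use assms in simp)

theorem manin_cayley_hamilton:
  fixes M :: "'a::ring_1 mat"
  assumes M: "M \<in> carrier_mat n n" and manin: "manin_matrix M"
    and k: "k < n" and j: "j < n"
  shows "(\<Sum>i\<le>n. Poly_Mapping.lookup (char_poly_col M) i * (M ^\<^sub>m i) $$ (k,j)) = 0"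
proof -
  define X where "X = poly_var \<cdot>\<^sub>m 1\<^sub>m n - map_mat poly_const M"
  define c where "c = Poly_Mapping.lookup (char_poly_col M)"
  \<comment> \<open>\<open>A i l\<close> is the coefficient of degree \<open>i\<close> in entry
    \<open>l\<close> of row \<open>k\<close> of the adjugate; the row stays fixed
    throughout.\<close>
  define A where "A = (\<lambda>i l. Poly_Mapping.lookup (cofactor X n k l) i)"
  have X: "X \<in> carrier_mat n n" "manin_matrix X"
    unfolding X_def using M manin_char_matrix[OF M manin] by auto
  have char: "char_poly_col M = det_col X"
    using M unfolding char_poly_col_def X_def by simp
  \<comment> \<open>Stated for every column \<open>j\<close>, since all columns enter when
    multiplying by a power of \<open>M\<close>. The case \<open>i = 0\<close> is separate because
    \<open>i - 1\<close> would truncate to 0.\<close>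
  have coeff: "(if k = j then c i else 0) = (if i = 0 then 0 else A (i - 1) j) - (\<Sum>l<n. A i l * M $$ (l,j))"
    if j: "j < n" for i j
  proof -
    have "(if k = j then c i else 0) = Poly_Mapping.lookup (if k = j then det_col X else 0) i"
      by (simp add: c_def char)
    also have "\<dots> = (\<Sum>l<n. Poly_Mapping.lookup (cofactor X n k l * X $$ (l,j)) i)"
      unfolding cofactor_mult[OF X k j, symmetric] lookup_sum ..
    also have "\<dots> = (\<Sum>l<n. (if l = j then (if i = 0 then 0 else A (i - 1) l) else 0) - A i l * M $$ (l,j))"
    proof (rule sum.cong)
      fix l assume "l \<in> {..<n}"
      then have "X $$ (l,j) = (if l = j then poly_var else 0) - poly_const (M $$ (l,j))"
        unfolding X_def using char_matrix_index[OF M _ j] by simp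
      then show "Poly_Mapping.lookup (cofactor X n k l * X $$ (l,j)) i
          = (if l = j then (if i = 0 then 0 else A (i - 1) l) else 0) - A i l * M $$ (l,j)"
        by (auto simp: A_def poly_var_def poly_const_def right_diff_distrib lookup_minus lookup_mult_single)
    qed simp
    also have "\<dots> = (if i = 0 then 0 else A (i - 1) j) - (\<Sum>l<n. A i l * M $$ (l,j))"
      using j by (simp add: sum_subtractf)
    finally show ?thesis .
  qed
  have pow: "(\<Sum>l<n. M $$ (m,l) * (M ^\<^sub>m i) $$ (l,j)) = (M ^\<^sub>m Suc i) $$ (m,j)" if "m < n" for m i
    unfolding pow_mat_Suc_left[OF M] using that j M by (intro index_mult_mat_sum[symmetric]) auto
  have step: "c i * (M ^\<^sub>m i) $$ (k,j) =
      (\<Sum>l<n. (if i = 0 then 0 else A (i - 1) l) * (M ^\<^sub>m i) $$ (l,j))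
      - (\<Sum>l<n. A i l * (M ^\<^sub>m Suc i) $$ (l,j))" for i
  proof -
    have "c i * (M ^\<^sub>m i) $$ (k,j) = (\<Sum>l<n. (if k = l then c i else 0) * (M ^\<^sub>m i) $$ (l,j))"
      using k by (simp add: if_distrib[of "\<lambda>x. x * _"] cong: if_cong)
    also have "\<dots> = (\<Sum>l<n. (if i = 0 then 0 else A (i - 1) l) * (M ^\<^sub>m i) $$ (l,j))
        - (\<Sum>l<n. \<Sum>m<n. A i m * (M $$ (m,l) * (M ^\<^sub>m i) $$ (l,j)))"
      unfolding sum_subtractf[symmetric]
      by (rule sum.cong) (simp_all only: coeff lessThan_iff left_diff_distrib sum_distrib_right mult.assoc)
    also have "(\<Sum>l<n. \<Sum>m<n. A i m * (M $$ (m,l) * (M ^\<^sub>m i) $$ (l,j)))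
        = (\<Sum>m<n. A i m * (M ^\<^sub>m Suc i) $$ (m,j))"
      by (subst sum.swap) (simp add: pow flip: sum_distrib_left del: pow_mat.simps)
    finally show ?thesis .
  qed
  \<comment> \<open>Consecutive steps cancel, which leaves only the upper boundary term.\<close>
  have telescope: "(\<Sum>i\<le>N. c i * (M ^\<^sub>m i) $$ (k,j)) = - (\<Sum>l<n. A N l * (M ^\<^sub>m Suc N) $$ (l,j))" for N
    by (induction N) (simp_all add: step del: pow_mat.simps)
  \<comment> \<open>The bound \<open>N\<close> exceeds every degree in row \<open>k\<close> of the
    adjugate, so the boundary term at \<open>N + n\<close> vanishes; adding \<open>n\<close> makes
    the sum include all coefficients of the characteristic polynomial.\<close>
  have "finite (\<Union>l<n. Poly_Mapping.keys (cofactor X n k l))"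
    by simp
  then obtain N where N: "\<forall>i\<in>(\<Union>l<n. Poly_Mapping.keys (cofactor X n k l)). i < N"
    unfolding finite_nat_set_iff_bounded by blast
  have "A (N + n) l = 0" if "l < n" for l
  proof (rule ccontr)
    assume "A (N + n) l \<noteq> 0"
    then have "N + n \<in> (\<Union>l<n. Poly_Mapping.keys (cofactor X n k l))"
      using that unfolding A_def in_keys_iff[symmetric] by blast
    then show False
      using N by fastforce
  qed
  then have "(\<Sum>i\<le>N + n. c i * (M ^\<^sub>m i) $$ (k,j)) = 0"
    unfolding telescope by simp
  moreover have "(\<Sum>i\<le>N + n. c i * (M ^\<^sub>m i) $$ (k,j)) = (\<Sum>i\<le>n. c i * (M ^\<^sub>m i) $$ (k,j))"
    by (rule sum.mono_neutral_right) (auto simp: c_def lookup_char_poly_col(1)[OF M])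
  ultimately show ?thesis
    unfolding c_def by simp
qed

section \<open>The Krylov matrix and its Frobenius companion\<close>

theorem corollary6:
  fixes M :: "'a::complex_algebra_1 mat"
    and v :: "'a vec"
    and \<sigma> :: "nat \<Rightarrow> 'a"
    and n :: nat
  assumes "M \<in> carrier_mat n n"
    and "manin_matrix M"
    and "char_poly_col M =
      (\<Sum>i=0..n. (-1) ^ i * poly_const (\<sigma> i) * poly_var ^ (n - i))"
    and "v \<in> carrier_vec n"
    and "\<And>k l. k < n \<Longrightarrow> l \<le> n \<Longrightarrow> v $ k * \<sigma> l = \<sigma> l * v $ k"
  shows "krylov_mat n v M * M = frobenius_mat n \<sigma> * krylov_mat n v M"
proof (rule eq_matI)
  note M = assms(1)
  \<comment> \<open>Entry \<open>j\<close> of \<open>v\<close> times the power \<open>i\<close> of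
    \<open>M\<close>, also for \<open>i = n\<close>, which is one past the last row of the Krylov
    matrix.\<close>
  define w where "w = (\<lambda>i j. \<Sum>l<n. v $ l * (M ^\<^sub>m i) $$ (l,j))"
  have K: "krylov_mat n v M \<in> carrier_mat n n"
    unfolding krylov_mat_def by (intro carrier_matI) simp_all
  have F: "frobenius_mat n \<sigma> \<in> carrier_mat n n"
    unfolding frobenius_mat_def by simp
  have krylov: "krylov_mat n v M $$ (i,j) = w i j" if "i < n" "j < n" for i j
  proof -
    have "(mat_of_row v * M ^\<^sub>m i) $$ (0,j) = w i j"
      using index_mult_mat_sum[of "mat_of_row v" 1 n "M ^\<^sub>m i" n 0 j] M assms(4) that
      by (simp add: w_def)
    then show ?thesis
      using that M assms(4) by (simp add: krylov_mat_def mat_of_rows_def)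
  qed
  have w_Suc: "(\<Sum>m<n. w i m * M $$ (m,j)) = w (Suc i) j" if "j < n" for i j
  proof -
    have "(\<Sum>m<n. w i m * M $$ (m,j)) = (\<Sum>l<n. v $ l * (\<Sum>m<n. (M ^\<^sub>m i) $$ (l,m) * M $$ (m,j)))"
      unfolding w_def sum_distrib_right sum_distrib_left mult.assoc by (rule sum.swap)
    also have "\<dots> = w (Suc i) j"
      unfolding w_def using M that
      by (intro sum.cong refl) (simp add: index_mult_mat_sum[of _ n n _ n] del: index_mult_mat)
    finally show ?thesis .
  qed
  have coeff: "Poly_Mapping.lookup (char_poly_col M) m = (-1) ^ (n - m) * \<sigma> (n - m)" if "m \<le> n" for m
  proof -
    have "Poly_Mapping.lookup (char_poly_col M) m = (\<Sum>i=0..n. if i = n - m then (-1) ^ i * \<sigma> i else 0)"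
      unfolding assms(3) lookup_sum lookup_monomial_term by (rule sum.cong) (use that in auto)
    then show ?thesis
      by simp
  qed
  \<comment> \<open>Cayley-Hamilton solved for its leading term; the change of sign turns the
    exponent \<open>n - m\<close> into \<open>n + 1 - m\<close>.\<close>
  have pow_n: "(M ^\<^sub>m n) $$ (l,j) = (\<Sum>m<n. (-1) ^ (n + 1 - m) * \<sigma> (n - m) * (M ^\<^sub>m m) $$ (l,j))"
    if "l < n" "j < n" for l j
  proof -
    have "0 = (\<Sum>m<n. Poly_Mapping.lookup (char_poly_col M) m * (M ^\<^sub>m m) $$ (l,j)) + (M ^\<^sub>m n) $$ (l,j)"
      using manin_cayley_hamilton[OF M assms(2) that] lookup_char_poly_col(2)[OF M]
      by (simp flip: lessThan_Suc_atMost)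
    then have "(M ^\<^sub>m n) $$ (l,j) = - (\<Sum>m<n. Poly_Mapping.lookup (char_poly_col M) m * (M ^\<^sub>m m) $$ (l,j))"
      by (metis add.commute eq_neg_iff_add_eq_0)
    also have "\<dots> = (\<Sum>m<n. (-1) ^ (n + 1 - m) * \<sigma> (n - m) * (M ^\<^sub>m m) $$ (l,j))"
      unfolding sum_negf[symmetric] by (rule sum.cong) (auto simp: coeff Suc_diff_le)
    finally show ?thesis .
  qed
  \<comment> \<open>The commutation hypothesis enters here: it lets the entries of \<open>v\<close>
    pass the coefficients and reach the powers of \<open>M\<close>.\<close>
  have commute: "v $ l * ((-1) ^ i * \<sigma> m * x) = (-1) ^ i * \<sigma> m * (v $ l * x)"
    if "l < n" "m \<le> n" for l m i x
    using assms(5)[OF that] by (cases "even i") (simp_all add: mult.assoc[symmetric])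
  have w_n: "w n j = (\<Sum>m<n. (-1) ^ (n + 1 - m) * \<sigma> (n - m) * w m j)" if "j < n" for j
  proof -
    have "w n j = (\<Sum>l<n. \<Sum>m<n. (-1) ^ (n + 1 - m) * \<sigma> (n - m) * (v $ l * (M ^\<^sub>m m) $$ (l,j)))"
      unfolding w_def
      by (intro sum.cong refl) (simp add: pow_n that sum_distrib_left commute)
    also have "\<dots> = (\<Sum>m<n. (-1) ^ (n + 1 - m) * \<sigma> (n - m) * w m j)"
      unfolding w_def sum_distrib_left by (rule sum.swap)
    finally show ?thesis .
  qed
  fix i j assume "i < dim_row (frobenius_mat n \<sigma> * krylov_mat n v M)"
    "j < dim_col (frobenius_mat n \<sigma> * krylov_mat n v M)"
  then have ij: "i < n" "j < n"
    using F K by auto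
  have "(krylov_mat n v M * M) $$ (i,j) = w (Suc i) j"
    using index_mult_mat_sum[OF K M ij] ij by (simp add: krylov w_Suc)
  \<comment> \<open>Above the last row the single 1 selects the next Krylov row; the last row is the
    recurrence \<open>w_n\<close>.\<close>
  also have "\<dots> = (\<Sum>m<n. frobenius_mat n \<sigma> $$ (i,m) * w m j)"
  proof (cases "Suc i < n")
    case True
    then show ?thesis
      using ij by (simp add: frobenius_mat_def if_distrib[of "\<lambda>x. x * _"] cong: if_cong)
  next
    case False
    then have "Suc i = n"
      using ij by simp
    then show ?thesis
      using ij w_n by (simp add: frobenius_mat_def)
  qed
  also have "\<dots> = (frobenius_mat n \<sigma> * krylov_mat n v M) $$ (i,j)"
    using index_mult_mat_sum[OF F K ij] ij by (simp add: krylov)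
  finally show "(krylov_mat n v M * M) $$ (i,j) = (frobenius_mat n \<sigma> * krylov_mat n v M) $$ (i,j)" .
qed (use assms(1) in \<open>auto simp: krylov_mat_def frobenius_mat_def\<close>)

end
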